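(* Let $f:\mathbb{R}^n\to\mathbb{R}$ be $L$-smooth with $\arg\min f\neq\emptyset$, let $x^\star\in\arg\min f$, $f^\star=f(x^\star)$, and let $h>0$. Let $\{x_k\}_{k=0}^\infty\subset\mathbb{R}^n$ and $\{\eta_k\}_{k=0}^\infty\subset\mathbb{R}$ be sequences satisfying, for all $k\ge0$, $$\frac{x_{k+1}-x_k}{h}=-\eta_k\nabla f(x_k),\qquad f(x_{k+1})-f(x_k)=\eta_k\langle\nabla f(x_k),x_{k+1}-x_k\rangle,$$ and $\eta_k\neq0$ for any non-negative integer $k$. If $f$ is convex, then $$f(x_k)-f^\star=O\left(\frac1k\right)\quad(k\to\infty).$$ In particular, if $h\leq\frac2L$, then for every integer $k\ge1$ $$f(x_k)-f^\star\leq\left(\frac{Lh+2}{4}\right)\frac{\|x_0-x^\star\|^2}{kh}.$$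
   Context: A function $f$ is $L$-smooth ($L>0$) if it is differentiable and $\nabla f$ is Lipschitz continuous with constant $L$. $\|\cdot\|$ is the Euclidean norm. *)

theory Defs
  imports "HOL-Analysis.Analysis" "HOL-Library.Landau_Symbols"
begin

(* Meaningful only where f is differentiable; unspecified otherwise. *)
definition gradient :: "('a::euclidean_space \<Rightarrow> real) \<Rightarrow> 'a \<Rightarrow> 'a" where
  "gradient f x = (THE D. GDERIV f x :> D)"

definition L_smooth :: "real \<Rightarrow> ('a::euclidean_space \<Rightarrow> real) \<Rightarrow> bool" where
  "L_smooth L f \<longleftrightarrow> L > 0 \<and> (\<forall>x. f differentiable (at x)) \<and> L-lipschitz_on UNIV (gradient f)"

lemma gradient_eqI:
  assumes "GDERIV f x :> D"
  shows "gradient f x = D"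
  unfolding gradient_def
proof (rule the_equality)
  show "GDERIV f x :> D" by (fact assms)
next
  fix E assume "GDERIV f x :> E"
  then have "(\<lambda>h. inner h E) = (\<lambda>h. inner h D)"
    using assms unfolding gderiv_def by (rule has_derivative_unique)
  then show "E = D"
    by (metis inner_commute vector_eq_ldot)
qed

lemma GDERIV_gradient:
  assumes "f differentiable (at x)"
  shows "GDERIV f x :> gradient f x"
proof -
  from assms obtain f' where f': "(f has_derivative f') (at x)"
    unfolding differentiable_def by blast
  interpret linear f' using f' by (rule has_derivative_linear)
  have "f' = (\<lambda>h. inner h (adjoint f' 1))"
    using adjoint_works[OF linear_axioms] by (simp add: fun_eq_iff)
  with f' have "GDERIV f x :> adjoint f' 1" unfolding gderiv_def by simp
  with gradient_eqI[OF this] show ?thesis by simp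
qed

end

theory Submission
  imports Defs
begin

text \<open>
  Write \<open>g = \<nabla>f(x\<^sub>k)\<close>, \<open>c = 2 / (L h + 2)\<close>, \<open>D\<^sub>k = \<parallel>x\<^sub>k - x\<^sup>\<star>\<parallel>\<^sup>2\<close> and \<open>\<delta>\<^sub>k = f(x\<^sub>k) - f\<^sup>\<star>\<close>.
  Both equations together give \<open>\<delta>\<^sub>k - \<delta>\<^bsub>k+1\<^esub> = h \<eta>\<^sub>k\<^sup>2 \<parallel>g\<parallel>\<^sup>2\<close>. Comparing this with the
  tangent inequality forces \<open>\<eta>\<^sub>k \<ge> 0\<close>, and then the descent lemma forces \<open>\<eta>\<^sub>k \<ge> c\<close>
  (if \<open>g = 0\<close>, the iterates are at a minimiser already). Expanding the square,
  \<open>D\<^sub>k - D\<^bsub>k+1\<^esub> = 2 h \<eta>\<^sub>k \<langle>g, x\<^sub>k - x\<^sup>\<star>\<rangle> - h (\<delta>\<^sub>k - \<delta>\<^bsub>k+1\<^esub>) \<ge> 2 h c \<delta>\<^sub>k - h (\<delta>\<^sub>k - \<delta>\<^bsub>k+1\<^esub>)\<close>.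
  Hence \<open>D + h \<delta>\<close> decreases by at least \<open>2 h c \<delta>\<^bsub>k+1\<^esub>\<close> in each step; if \<open>h \<le> 2 / L\<close>, that is
  \<open>2 c \<ge> 1\<close>, already \<open>D\<close> does. Both bounds follow by telescoping.
\<close>

lemma has_real_derivative_along_line:
  fixes f :: "'a::euclidean_space \<Rightarrow> real"
  assumes "f differentiable (at (x + t *\<^sub>R d))"
  shows "((\<lambda>s. f (x + s *\<^sub>R d)) has_real_derivative gradient f (x + t *\<^sub>R d) \<bullet> d) (at t)"
proof -
  have "(f has_derivative (\<lambda>v. v \<bullet> gradient f (x + t *\<^sub>R d))) (at (x + t *\<^sub>R d))"
    using GDERIV_gradient[OF assms] unfolding gderiv_def .
  moreover have "((\<lambda>s. x + s *\<^sub>R d) has_derivative (\<lambda>s. s *\<^sub>R d)) (at t)"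
    by (auto intro!: derivative_eq_intros)
  ultimately have "((\<lambda>s. f (x + s *\<^sub>R d)) has_derivative
      (\<lambda>s. (s *\<^sub>R d) \<bullet> gradient f (x + t *\<^sub>R d))) (at t)"
    by (rule has_derivative_compose[rotated])
  moreover have "(\<lambda>s. (s *\<^sub>R d) \<bullet> gradient f (x + t *\<^sub>R d)) = (*) (gradient f (x + t *\<^sub>R d) \<bullet> d)"
    by (auto simp: fun_eq_iff inner_commute)
  ultimately show ?thesis
    by (simp add: has_field_derivative_def)
qed

text \<open>Restricted to the line through \<open>x\<close> and \<open>y\<close>, \<open>f\<close>
  is a convex function of one real variable, so the one-variable tangent inequality applies between
  parameters 0 and 1.\<close>

lemma convex_on_above_gradient:
  fixes f :: "'a::euclidean_space \<Rightarrow> real"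
  assumes "convex_on UNIV f" and "f differentiable (at x)"
  shows "f x + gradient f x \<bullet> (y - x) \<le> f y"
proof -
  define \<phi> where "\<phi> = (\<lambda>t::real. f (x + t *\<^sub>R (y - x)))"
  have "convex_on UNIV \<phi>"
  proof (rule convex_onI)
    fix t a b :: real assume "0 < t" "t < 1"
    have "x + ((1 - t) *\<^sub>R a + t *\<^sub>R b) *\<^sub>R (y - x)
        = (1 - t) *\<^sub>R (x + a *\<^sub>R (y - x)) + t *\<^sub>R (x + b *\<^sub>R (y - x))"
      by (simp add: algebra_simps)
    then show "\<phi> ((1 - t) *\<^sub>R a + t *\<^sub>R b) \<le> (1 - t) * \<phi> a + t * \<phi> b"
      unfolding \<phi>_def using convex_onD[OF assms(1)] \<open>0 < t\<close> \<open>t < 1\<close> by simp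
  qed simp
  moreover have "(\<phi> has_real_derivative gradient f x \<bullet> (y - x)) (at 0)"
    using has_real_derivative_along_line[of f x 0 "y - x"] assms(2) by (simp add: \<phi>_def)
  ultimately have "\<phi> 1 - \<phi> 0 \<ge> (gradient f x \<bullet> (y - x)) * (1 - 0)"
    by (intro convex_on_imp_above_tangent[where A = UNIV]) auto
  then show ?thesis
    by (simp add: \<phi>_def)
qed

lemma L_smooth_descent:
  fixes f :: "'a::euclidean_space \<Rightarrow> real"
  assumes "L_smooth L f"
  shows "f y \<le> f x + gradient f x \<bullet> (y - x) + L / 2 * (norm (y - x))\<^sup>2"
proof -
  define d where "d = y - x"
  define \<phi> where "\<phi> = (\<lambda>t. f (x + t *\<^sub>R d) - t * (gradient f x \<bullet> d) - L / 2 * t\<^sup>2 * (norm d)\<^sup>2)"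
  have diff: "\<And>z. f differentiable (at z)" and lip: "L-lipschitz_on UNIV (gradient f)"
    using assms by (auto simp: L_smooth_def)
  have "\<phi> 1 \<le> \<phi> 0"
  proof (rule DERIV_nonpos_imp_nonincreasing[where f = \<phi> and a = 0 and b = 1])
    fix t :: real assume "0 \<le> t" "t \<le> 1"
    let ?D = "(gradient f (x + t *\<^sub>R d) - gradient f x) \<bullet> d - L * t * (norm d)\<^sup>2"
    have "(\<phi> has_real_derivative ?D) (at t)"
      unfolding \<phi>_def
      by (rule derivative_eq_intros has_real_derivative_along_line diff refl)+
         (simp add: inner_diff_left)
    moreover have "?D \<le> 0"
    proof -
      have "(gradient f (x + t *\<^sub>R d) - gradient f x) \<bullet> d
          \<le> norm (gradient f (x + t *\<^sub>R d) - gradient f x) * norm d"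
        by (rule norm_cauchy_schwarz)
      also have "\<dots> \<le> (L * (t * norm d)) * norm d"
        using lipschitz_onD[OF lip, of "x + t *\<^sub>R d" x] \<open>0 \<le> t\<close>
        by (intro mult_right_mono) (auto simp: dist_norm)
      finally show ?thesis by (simp add: power2_eq_square mult_ac)
    qed
    ultimately show "\<exists>D. (\<phi> has_real_derivative D) (at t) \<and> D \<le> 0" by blast
  qed simp
  then show ?thesis
    by (simp add: \<phi>_def d_def)
qed

text \<open>The first \<open>k\<close> decreases involve \<open>\<delta> 1\<close> to
  \<open>\<delta> k\<close>, of which \<open>\<delta> k\<close> is the smallest; their sum
  telescopes.\<close>

lemma antimono_telescope_bound:
  fixes E \<delta> :: "nat \<Rightarrow> real"
  assumes "a \<ge> 0" and "antimono \<delta>" and "E k \<ge> 0"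
    and decrease: "\<And>j. a * \<delta> (Suc j) \<le> E j - E (Suc j)"
  shows "real k * (a * \<delta> k) \<le> E 0"
proof -
  have "real k * (a * \<delta> k) = (\<Sum>j<k. a * \<delta> k)"
    by simp
  also have "\<dots> \<le> (\<Sum>j<k. E j - E (Suc j))"
  proof (rule sum_mono)
    fix j assume "j \<in> {..<k}"
    then have "a * \<delta> k \<le> a * \<delta> (Suc j)"
      using \<open>a \<ge> 0\<close> \<open>antimono \<delta>\<close> by (intro mult_left_mono) (auto simp: antimono_def)
    with decrease[of j] show "a * \<delta> k \<le> E j - E (Suc j)" by linarith
  qed
  also have "\<dots> = E 0 - E k"
    by (rule sum_lessThan_telescope')
  finally show ?thesis using \<open>E k \<ge> 0\<close> by simp
qed

text \<open>The two equations fix the change of \<open>f\<close> as exactly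
  \<open>- h * \<eta>\<^sup>2 * G\<close>; the tangent and descent inequalities enclose it from
  below and above.\<close>

lemma step_factor_lower_bound:
  fixes f :: "'a::euclidean_space \<Rightarrow> real"
  assumes smooth: "L_smooth L f" and convex: "convex_on UNIV f" and "h > 0" and "\<eta> \<noteq> 0"
    and step: "y - x = - (h * \<eta>) *\<^sub>R gradient f x"
    and energy: "f y - f x = \<eta> * (gradient f x \<bullet> (y - x))"
    and nz: "gradient f x \<noteq> 0"
  shows "2 / (L * h + 2) \<le> \<eta>"
proof -
  define G where "G = (norm (gradient f x))\<^sup>2"
  have "G > 0" using nz by (simp add: G_def)
  have "L > 0" and diff: "f differentiable (at x)"
    using smooth by (auto simp: L_smooth_def)
  have inner: "gradient f x \<bullet> (y - x) = - (h * \<eta>) * G"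
    by (simp add: step G_def power2_norm_eq_inner)
  have "(norm (y - x))\<^sup>2 = (h * \<eta>)\<^sup>2 * G"
    by (simp add: step G_def power_mult_distrib)
  with L_smooth_descent[OF smooth, of y x]
  have upper: "f y \<le> f x + - (h * \<eta>) * G + L / 2 * ((h * \<eta>)\<^sup>2 * G)"
    by (simp add: inner)
  from convex_on_above_gradient[OF convex diff, of y]
  have lower: "f x + - (h * \<eta>) * G \<le> f y"
    by (simp only: inner)
  have "(h * G) * \<eta>\<^sup>2 \<le> (h * G) * \<eta>"
    using lower energy by (simp add: inner power2_eq_square mult_ac)
  then have "\<eta>\<^sup>2 \<le> \<eta>"
    using \<open>h > 0\<close> \<open>G > 0\<close> by simp
  moreover have "0 < \<eta>\<^sup>2"
    using \<open>\<eta> \<noteq> 0\<close> by simp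
  ultimately have "\<eta> > 0"
    by linarith
  \<comment> \<open>The descent bound multiplied by 2, with the common factor
    \<open>h * G * \<eta>\<close> split off; cancelling it relies on the sign of
    \<open>\<eta>\<close> just found.\<close>
  have "(h * G * \<eta>) * 2 \<le> (h * G * \<eta>) * (\<eta> * (L * h + 2))"
    using upper energy[unfolded inner] by (simp add: power2_eq_square algebra_simps)
  then have "2 \<le> \<eta> * (L * h + 2)"
    using \<open>h > 0\<close> \<open>G > 0\<close> \<open>\<eta> > 0\<close> by simp
  moreover have "L * h + 2 > 0"
    using \<open>L > 0\<close> \<open>h > 0\<close> by (simp add: add_pos_pos)
  ultimately show ?thesis
    by (simp add: divide_le_eq)
qed

text \<open>In the expansion of \<open>(norm (y - z))\<^sup>2\<close> the quadratic term
  \<open>(h * \<eta>)\<^sup>2 * (g \<bullet> g)\<close> is exactly \<open>h * (f x - f y)\<close>,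
  so only the linear term has to be estimated.\<close>

lemma one_step_decrease:
  fixes f :: "'a::euclidean_space \<Rightarrow> real"
  assumes smooth: "L_smooth L f" and convex: "convex_on UNIV f" and "h > 0" and "\<eta> \<noteq> 0"
    and step: "y - x = - (h * \<eta>) *\<^sub>R gradient f x"
    and energy: "f y - f x = \<eta> * (gradient f x \<bullet> (y - x))"
    and min: "f z \<le> f x"
  shows "2 * h * (2 / (L * h + 2)) * (f x - f z)
      \<le> (norm (x - z))\<^sup>2 - (norm (y - z))\<^sup>2 + h * (f x - f y)"
    and "f y \<le> f x"
proof -
  define g where "g = gradient f x"
  have drop: "f x - f y = h * \<eta>\<^sup>2 * (g \<bullet> g)"
    using energy by (simp add: step g_def power2_eq_square mult_ac)
  then show "f y \<le> f x"
    using \<open>h > 0\<close> by (metis diff_ge_0_iff_ge inner_ge_zero less_imp_le mult_nonneg_nonneg zero_le_power2)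
  have diff: "f differentiable (at x)"
    using smooth by (simp add: L_smooth_def)
  have tangent: "f x - f z \<le> g \<bullet> (x - z)"
    using convex_on_above_gradient[OF convex diff, of z] by (simp add: g_def inner_diff_right)
  have "2 / (L * h + 2) * (f x - f z) \<le> \<eta> * (g \<bullet> (x - z))"
  proof (cases "g = 0")
    case True
    \<comment> \<open>Without a lower bound on \<open>\<eta>\<close> here, both sides must vanish:
      the tangent inequality gives \<open>f x \<le> f z\<close>.\<close>
    with tangent min have "f x - f z = 0" by simp
    with True show ?thesis by simp
  next
    case False
    then have c: "2 / (L * h + 2) \<le> \<eta>"
      using step_factor_lower_bound[OF smooth convex \<open>h > 0\<close> \<open>\<eta> \<noteq> 0\<close> step energy]
      by (simp add: g_def)
    moreover have "0 < 2 / (L * h + 2)"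
      using smooth \<open>h > 0\<close> by (simp add: L_smooth_def add_pos_pos)
    ultimately have "0 \<le> \<eta>" by linarith
    with c tangent min show ?thesis by (intro mult_mono) auto
  qed
  then have "2 * h * (2 / (L * h + 2) * (f x - f z)) \<le> 2 * h * (\<eta> * (g \<bullet> (x - z)))"
    using \<open>h > 0\<close> by (intro mult_left_mono) auto
  moreover have "y - z = (x - z) - (h * \<eta>) *\<^sub>R g"
    using step by (simp add: g_def algebra_simps)
  then have "(norm (y - z))\<^sup>2
      = (norm (x - z))\<^sup>2 - 2 * h * (\<eta> * (g \<bullet> (x - z))) + h * (f x - f y)"
    unfolding drop power2_norm_eq_inner
    by (simp only:)
       (simp add: inner_diff_left inner_diff_right inner_commute power2_eq_square algebra_simps)
  ultimately show "2 * h * (2 / (L * h + 2)) * (f x - f z)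
      \<le> (norm (x - z))\<^sup>2 - (norm (y - z))\<^sup>2 + h * (f x - f y)"
    by (simp only: mult.assoc)
qed

theorem theorem4p3:
  fixes f :: "real ^ 'n \<Rightarrow> real"
    and L h fstar :: real
    and xstar :: "real ^ 'n"
    and x :: "nat \<Rightarrow> real ^ 'n"
    and \<eta> :: "nat \<Rightarrow> real"
  assumes smooth: "L_smooth L f"
    and xstar: "is_arg_min f (\<lambda>_. True) xstar"
    and fstar: "fstar = f xstar"
    and h: "h > 0"
    and step: "\<And>k. (x (Suc k) - x k) /\<^sub>R h = - \<eta> k *\<^sub>R gradient f (x k)"
    and energy: "\<And>k. f (x (Suc k)) - f (x k) = \<eta> k * (gradient f (x k) \<bullet> (x (Suc k) - x k))"
    and nonzero: "\<And>k. \<eta> k \<noteq> 0"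
    and convex: "convex_on UNIV f"
  shows "(\<lambda>k. f (x k) - fstar) \<in> O(\<lambda>k. 1 / real k) \<and>
    (h \<le> 2 / L \<longrightarrow>
      (\<forall>k\<ge>1. f (x k) - fstar \<le> ((L * h + 2) / 4) * ((norm (x 0 - xstar))\<^sup>2 / (real k * h))))"
proof -
  define \<delta> where "\<delta> = (\<lambda>k. f (x k) - fstar)"
  define D where "D = (\<lambda>k. (norm (x k - xstar))\<^sup>2)"
  define c where "c = 2 / (L * h + 2)"
  have "L > 0" using smooth by (simp add: L_smooth_def)
  then have Lh: "L * h > 0" using h by simp
  then have "c > 0" by (simp add: c_def)
  have min: "f xstar \<le> f z" for z
    using xstar by (auto simp: is_arg_min_def not_less)
  have \<delta>_nonneg: "\<delta> k \<ge> 0" for k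
    using min by (simp add: \<delta>_def fstar)
  have step': "x (Suc k) - x k = - (h * \<eta> k) *\<^sub>R gradient f (x k)" for k
  proof -
    have "x (Suc k) - x k = h *\<^sub>R ((x (Suc k) - x k) /\<^sub>R h)"
      using h by simp
    then show ?thesis by (simp only: step) simp
  qed
  note decrease = one_step_decrease[OF smooth convex h nonzero step' energy min]
  have mono: "\<delta> (Suc k) \<le> \<delta> k" for k
    using decrease(2) by (simp add: \<delta>_def)
  then have "antimono \<delta>" by (simp add: decseq_Suc_iff)
  have dec: "2 * h * c * \<delta> k \<le> D k - D (Suc k) + h * (\<delta> k - \<delta> (Suc k))" for k
    using decrease(1)[of k] by (simp add: \<delta>_def D_def c_def fstar)
  have bound: "real k * (2 * h * c * \<delta> k) \<le> D 0 + h * \<delta> 0" for k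
  proof (rule antimono_telescope_bound[where E = "\<lambda>k. D k + h * \<delta> k"])
    fix j
    \<comment> \<open>Weakening from \<open>\<delta> j\<close> to \<open>\<delta> (Suc j)\<close>
      puts the decrease in the form that the telescoping lemma expects.\<close>
    have "2 * h * c * \<delta> (Suc j) \<le> 2 * h * c * \<delta> j"
      using mono h \<open>c > 0\<close> by (intro mult_left_mono) auto
    then show "2 * h * c * \<delta> (Suc j) \<le> D j + h * \<delta> j - (D (Suc j) + h * \<delta> (Suc j))"
      using dec[of j] unfolding right_diff_distrib by linarith
  qed (use h \<open>c > 0\<close> \<delta>_nonneg \<open>antimono \<delta>\<close> in \<open>auto simp: D_def\<close>)
  have "\<delta> \<in> O(\<lambda>k. 1 / real k)"
  proof (rule bigoI)
    show "\<forall>\<^sub>F k in sequentially.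
        norm (\<delta> k) \<le> (D 0 + h * \<delta> 0) / (2 * h * c) * norm (1 / real k)"
      \<comment> \<open>The index 0 is excluded because \<open>1 / real 0\<close> is 0.\<close>
      using eventually_gt_at_top[of 0]
    proof eventually_elim
      case (elim k)
      then show ?case
        using bound[of k] h \<open>c > 0\<close> \<delta>_nonneg[of k] by (simp add: field_simps)
    qed
  qed
  moreover have "\<delta> k \<le> ((L * h + 2) / 4) * (D 0 / (real k * h))" if "h \<le> 2 / L" "k \<ge> 1" for k
  proof -
    have "L * h \<le> 2"
      using that(1) \<open>L > 0\<close> by (simp add: field_simps)
    then have "2 * c \<ge> 1"
      using Lh by (simp add: c_def field_simps)
    have "real k * (2 * h * c * \<delta> k) \<le> D 0"
    proof (rule antimono_telescope_bound[where E = D])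
      fix j
      \<comment> \<open>As \<open>2 * c \<ge> 1\<close>, the drop term of \<open>dec\<close> is at
        most \<open>2 * h * c * (\<delta> j - \<delta> (Suc j))\<close>; subtracting this from
        \<open>2 * h * c * \<delta> j\<close> leaves the term at \<open>Suc j\<close>, so
        \<open>D\<close> alone serves as potential.\<close>
      have "h * (\<delta> j - \<delta> (Suc j)) * 1 \<le> h * (\<delta> j - \<delta> (Suc j)) * (2 * c)"
        using \<open>2 * c \<ge> 1\<close> h mono[of j] by (intro mult_left_mono) auto
      then show "2 * h * c * \<delta> (Suc j) \<le> D j - D (Suc j)"
        using dec[of j] by (simp add: algebra_simps)
    qed (use h \<open>c > 0\<close> \<open>antimono \<delta>\<close> in \<open>auto simp: D_def\<close>)
    then have "\<delta> k \<le> D 0 / (real k * (2 * h * c))"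
      using that(2) h \<open>c > 0\<close> by (simp add: pos_le_divide_eq mult_ac)
    \<comment> \<open>The constant is \<open>1 / (2 * c)\<close>.\<close>
    also have "\<dots> = ((L * h + 2) / 4) * (D 0 / (real k * h))"
      by (simp add: c_def mult_ac)
    finally show ?thesis .
  qed
  ultimately show ?thesis
    by (simp add: \<delta>_def D_def)
qed

end
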